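(* Let $A$ be an MV-semiring. For any non-empty set $X$, $A$ can be embedded (as a semiring) in the endomorphism semiring $\mathrm{End}\left((A^\vee)^{(X)}\right)$ of the join-semilattice $(A^\vee)^{(X)}$ of functions with finite support from $X$ to $A$, with pointwise join. In particular $A$ is embeddable in the semiring $\mathrm{End}(A^\vee)$ of the endomorphisms of its join-semilattice reduct.
   Context: A semiring $\langle S,+,\cdot,0,1\rangle$: $\langle S,+,0\rangle$ is a commutative monoid, $\langle S,\cdot,1\rangle$ is a monoid, $\cdot$ distributes over $+$ from both sides, and $0\cdot a=0=a\cdot 0$. An MV-semiring is a commutative, additively idempotent semiring $\langle A,\vee,\cdot,0,1\rangle$ for which there exists a map ${}^*:A\to A$ (the negation) satisfying, for all $a,b\in A$: (i) $a\cdot b=0$ iff $b\le a^*$ (where $a\le b$ iff $a\vee b=b$); (ii) $a\vee b=(a^*\cdot(a^*\cdot b)^* )^*$. $A^\vee=\langle A,\vee,0\rangle$ is the join-semilattice reduct of $A$. $(A^\vee)^{(X)}$ is the set of functions $f:X\to A$ with $f(x)\neq 0$ for only finitely many $x$, with pointwise join and the constant zero function as neutral element. For a semilattice with identity $\langle M,\vee,\bot\rangle$ (commutative idempotent monoid), $\mathrm{End}(M)$ is the semiring of monoid endomorphisms of $M$, with pointwise join as sum, the $\bot$-constant map as zero, composition as product and $\mathrm{id}_M$ as unit. A semiring embedding is an injective map preserving both operations, $0$ and $1$. *)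

theory Defs
  imports "HOL-Algebra.Ring" "HOL-Algebra.Product_Groups"
begin

text \<open>Semirings are those of the library locale \<open>semiring\<close>; the join of an idempotent semiring is its
  addition \<open>\<oplus>\<close>.\<close>

definition join_le :: "('a, 'm) ring_scheme \<Rightarrow> 'a \<Rightarrow> 'a \<Rightarrow> bool"
  where "join_le A a b \<longleftrightarrow> a \<oplus>\<^bsub>A\<^esub> b = b"

text \<open>Following the definition, the negation is only required to exist; it is not part of the
  signature.\<close>

locale mv_semiring = semiring A + comm_monoid A for A (structure) +
  assumes add_idem: "a \<in> carrier A \<Longrightarrow> a \<oplus> a = a"
    and negation_exists:
      "\<exists>neg \<in> carrier A \<rightarrow> carrier A. \<forall>a \<in> carrier A. \<forall>b \<in> carrier A.
         (a \<otimes> b = \<zero> \<longleftrightarrow> join_le A b (neg a)) \<and>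
         a \<oplus> b = neg (neg a \<otimes> neg (neg a \<otimes> b))"

text \<open>A semilattice with identity is a commutative idempotent monoid, written multiplicatively as
  a record: \<open>\<otimes>\<close> is the join and \<open>\<one>\<close> is the bottom element.\<close>

locale semilattice_with_identity = comm_monoid M for M (structure) +
  assumes join_idem: "x \<in> carrier M \<Longrightarrow> x \<otimes> x = x"

definition join_reduct :: "('a, 'm) ring_scheme \<Rightarrow> 'a monoid"
  where "join_reduct A = \<lparr>carrier = carrier A, mult = add A, one = zero A\<rparr>"

text \<open>Functions on \<open>X\<close> are represented extensionally, i.e. they are \<open>undefined\<close> outside \<open>X\<close>.\<close>

definition finsupp :: "'a monoid \<Rightarrow> 'x set \<Rightarrow> ('x \<Rightarrow> 'a) monoid"
  where "finsupp M X =
    (product_group X (\<lambda>_. M))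
      \<lparr>carrier := {f \<in> X \<rightarrow>\<^sub>E carrier M. finite {x \<in> X. f x \<noteq> \<one>\<^bsub>M\<^esub>}}\<rparr>"

text \<open>Endomorphisms are represented extensionally on the carrier, so that equality of
  endomorphisms is equality of functions. Library homomorphisms (\<open>hom\<close>) need not preserve the
  unit of a monoid.\<close>

definition End :: "'a monoid \<Rightarrow> ('a \<Rightarrow> 'a) ring"
  where "End M =
    \<lparr>carrier = {h \<in> hom M M \<inter> extensional (carrier M). h \<one>\<^bsub>M\<^esub> = \<one>\<^bsub>M\<^esub>},
     mult = compose (carrier M),
     one = (\<lambda>x \<in> carrier M. x),
     zero = (\<lambda>x \<in> carrier M. \<one>\<^bsub>M\<^esub>),
     add = (\<lambda>g h. \<lambda>x \<in> carrier M. g x \<otimes>\<^bsub>M\<^esub> h x)\<rparr>"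

text \<open>Library ring homomorphisms (\<open>ring_hom\<close>) preserve \<open>\<oplus>\<close>, \<open>\<otimes>\<close> and \<open>\<one>\<close>; between semirings,
  preservation of \<open>\<zero>\<close> has to be added.\<close>

definition semiring_embedding ::
    "('a, 'm) ring_scheme \<Rightarrow> ('b, 'n) ring_scheme \<Rightarrow> ('a \<Rightarrow> 'b) \<Rightarrow> bool"
  where "semiring_embedding R S h \<longleftrightarrow>
    h \<in> ring_hom R S \<and> h \<zero>\<^bsub>R\<^esub> = \<zero>\<^bsub>S\<^esub> \<and> inj_on h (carrier R)"

definition embeddable :: "('a, 'm) ring_scheme \<Rightarrow> ('b, 'n) ring_scheme \<Rightarrow> bool"
  where "embeddable R S \<longleftrightarrow> (\<exists>h. semiring_embedding R S h)"

lemma (in mv_semiring) join_reduct_semilattice: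
  "semilattice_with_identity (join_reduct A)"
  by unfold_locales (auto simp: join_reduct_def a_ac add_idem Units_def)

lemma finsupp_semilattice:
  assumes "semilattice_with_identity M"
  shows "semilattice_with_identity (finsupp M X)"
proof -
  interpret semilattice_with_identity M by fact
  have fin: "finite {x \<in> X. f x \<otimes>\<^bsub>M\<^esub> g x \<noteq> \<one>\<^bsub>M\<^esub>}"
    if "f \<in> X \<rightarrow>\<^sub>E carrier M" "g \<in> X \<rightarrow>\<^sub>E carrier M"
      "finite {x \<in> X. f x \<noteq> \<one>\<^bsub>M\<^esub>}" "finite {x \<in> X. g x \<noteq> \<one>\<^bsub>M\<^esub>}" for f g
    by (rule finite_subset[of _ "{x \<in> X. f x \<noteq> \<one>\<^bsub>M\<^esub>} \<union> {x \<in> X. g x \<noteq> \<one>\<^bsub>M\<^esub>}"])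
       (use that in auto)
  show ?thesis
  proof (unfold_locales, goal_cases)
    case (1 f g)
    then have "{x \<in> X. (\<lambda>x\<in>X. f x \<otimes>\<^bsub>M\<^esub> g x) x \<noteq> \<one>\<^bsub>M\<^esub>} = {x \<in> X. f x \<otimes>\<^bsub>M\<^esub> g x \<noteq> \<one>\<^bsub>M\<^esub>}"
      by auto
    with 1 fin[of f g] show ?case
      by (auto simp: finsupp_def product_group_def intro!: m_closed)
  next
    case (2 f g h)
    then show ?case
      by (auto simp: finsupp_def product_group_def fun_eq_iff PiE_iff m_assoc restrict_def)
  next
    case 3
    have "{x \<in> X. (\<lambda>x\<in>X. \<one>\<^bsub>M\<^esub>) x \<noteq> \<one>\<^bsub>M\<^esub>} = {}" by auto
    then show ?case
      by (simp add: finsupp_def product_group_def)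
  next
    case (4 f)
    then show ?case
      by (auto simp: finsupp_def product_group_def fun_eq_iff PiE_iff extensional_def restrict_def)
  next
    case (5 f)
    then show ?case
      by (auto simp: finsupp_def product_group_def fun_eq_iff PiE_iff extensional_def restrict_def)
  next
    case (6 f g)
    then show ?case
      by (auto simp: finsupp_def product_group_def fun_eq_iff PiE_iff m_comm restrict_def)
  next
    case (7 f)
    then show ?case
      by (auto simp: finsupp_def product_group_def fun_eq_iff PiE_iff extensional_def join_idem restrict_def)
  qed
qed

lemma End_semiring:
  assumes "semilattice_with_identity M"
  shows "semiring (End M)"
proof -
  interpret semilattice_with_identity M by fact
  note [simp] = End_def compose_def restrict_def
  show ?thesis
  proof (intro semiring.intro abelian_monoid.intro semiring_axioms.intro comm_monoidI monoidI)
  qed (auto simp: hom_def Pi_iff fun_eq_iff extensional_def m_ac)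
qed

end

theory Submission
  imports Defs
begin

text \<open>The embedding sends \<open>a\<close> to multiplication by \<open>a\<close>. Left distributivity and \<open>a \<otimes> \<zero> = \<zero>\<close> say that
  each multiplication map is an endomorphism of the join-semilattice; right distributivity,
  associativity and the laws for \<open>\<zero>\<close> and \<open>\<one>\<close> say that the assignment is a semiring homomorphism.
  It is injective because \<open>a\<close> can be read off from the value of its map at \<open>\<one>\<close>. On functions of
  finite support the multiplication is taken pointwise, and the role of \<open>\<one>\<close> is played by a function
  with value \<open>\<one>\<close> at one point of \<open>X\<close> and \<open>\<zero>\<close> elsewhere; this is where \<open>X \<noteq> {}\<close> enters.
  In both cases \<open>A\<close> acts faithfully on a monoid, so the passage from actions to embeddings is
  isolated in \<open>faithful_action_embeddable\<close>.\<close>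

text \<open>An action of \<open>R\<close> on \<open>M\<close> that respects all operations is the same thing as a semiring
  homomorphism into \<open>End M\<close>; restricting the action maps to the carrier turns them into
  elements of \<open>End M\<close>, where equality of maps is equality on the carrier.\<close>

lemma faithful_action_embeddable:
  fixes act :: "'a \<Rightarrow> 'b \<Rightarrow> 'b"
  assumes "monoid M"
    and closed: "\<And>a x. a \<in> carrier R \<Longrightarrow> x \<in> carrier M \<Longrightarrow> act a x \<in> carrier M"
    and act_mult: "\<And>a x y. a \<in> carrier R \<Longrightarrow> x \<in> carrier M \<Longrightarrow> y \<in> carrier M \<Longrightarrow>
      act a (x \<otimes>\<^bsub>M\<^esub> y) = act a x \<otimes>\<^bsub>M\<^esub> act a y"
    and act_one: "\<And>a. a \<in> carrier R \<Longrightarrow> act a \<one>\<^bsub>M\<^esub> = \<one>\<^bsub>M\<^esub>"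
    and add_act: "\<And>a b x. a \<in> carrier R \<Longrightarrow> b \<in> carrier R \<Longrightarrow> x \<in> carrier M \<Longrightarrow>
      act (a \<oplus>\<^bsub>R\<^esub> b) x = act a x \<otimes>\<^bsub>M\<^esub> act b x"
    and mult_act: "\<And>a b x. a \<in> carrier R \<Longrightarrow> b \<in> carrier R \<Longrightarrow> x \<in> carrier M \<Longrightarrow>
      act (a \<otimes>\<^bsub>R\<^esub> b) x = act a (act b x)"
    and one_act: "\<And>x. x \<in> carrier M \<Longrightarrow> act \<one>\<^bsub>R\<^esub> x = x"
    and zero_act: "\<And>x. x \<in> carrier M \<Longrightarrow> act \<zero>\<^bsub>R\<^esub> x = \<one>\<^bsub>M\<^esub>"
    and faithful: "\<And>a b. a \<in> carrier R \<Longrightarrow> b \<in> carrier R \<Longrightarrow>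
      (\<And>x. x \<in> carrier M \<Longrightarrow> act a x = act b x) \<Longrightarrow> a = b"
  shows "embeddable R (End M)"
proof -
  interpret monoid M by fact
  let ?h = "\<lambda>a. \<lambda>x\<in>carrier M. act a x"
  have "?h \<in> ring_hom R (End M)"
  proof (rule ring_hom_memI)
    show "?h a \<in> carrier (End M)" if "a \<in> carrier R" for a
      using that by (simp add: End_def hom_def closed act_mult act_one)
    show "?h (a \<otimes>\<^bsub>R\<^esub> b) = ?h a \<otimes>\<^bsub>End M\<^esub> ?h b" if "a \<in> carrier R" "b \<in> carrier R" for a b
      using that by (auto simp: End_def compose_def fun_eq_iff mult_act closed)
    show "?h (a \<oplus>\<^bsub>R\<^esub> b) = ?h a \<oplus>\<^bsub>End M\<^esub> ?h b" if "a \<in> carrier R" "b \<in> carrier R" for a b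
      using that by (auto simp: End_def fun_eq_iff add_act)
    show "?h \<one>\<^bsub>R\<^esub> = \<one>\<^bsub>End M\<^esub>"
      by (auto simp: End_def fun_eq_iff one_act)
  qed
  moreover have "?h \<zero>\<^bsub>R\<^esub> = \<zero>\<^bsub>End M\<^esub>"
    by (auto simp: End_def fun_eq_iff zero_act)
  moreover have "inj_on ?h (carrier R)"
  proof (intro inj_onI faithful)
    show "act a x = act b x" if "?h a = ?h b" "x \<in> carrier M" for a b x
      using fun_cong[OF that(1), of x] that(2) by simp
  qed
  ultimately show ?thesis
    unfolding embeddable_def semiring_embedding_def by blast
qed

lemma finsupp_simps:
  "f \<in> carrier (finsupp M X) \<longleftrightarrow> f \<in> X \<rightarrow>\<^sub>E carrier M \<and> finite {x \<in> X. f x \<noteq> \<one>\<^bsub>M\<^esub>}"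
  "f \<otimes>\<^bsub>finsupp M X\<^esub> g = (\<lambda>x\<in>X. f x \<otimes>\<^bsub>M\<^esub> g x)"
  "\<one>\<^bsub>finsupp M X\<^esub> = (\<lambda>x\<in>X. \<one>\<^bsub>M\<^esub>)"
  by (simp_all add: finsupp_def product_group_def)

lemma join_reduct_simps:
  "carrier (join_reduct A) = carrier A"
  "x \<otimes>\<^bsub>join_reduct A\<^esub> y = x \<oplus>\<^bsub>A\<^esub> y"
  "\<one>\<^bsub>join_reduct A\<^esub> = \<zero>\<^bsub>A\<^esub>"
  by (simp_all add: join_reduct_def)

context mv_semiring
begin

theorem embeddable_End_join_reduct: "embeddable A (End (join_reduct A))"
proof (rule faithful_action_embeddable[where act = "\<lambda>a x. a \<otimes> x"])
  show "monoid (join_reduct A)"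
    using join_reduct_semilattice
    by (simp add: semilattice_with_identity_def comm_monoid_def)
  fix a b
  assume "a \<in> carrier A" "b \<in> carrier A"
    and "\<And>x. x \<in> carrier (join_reduct A) \<Longrightarrow> a \<otimes> x = b \<otimes> x"
  from this(1,2) this(3)[of \<one>] show "a = b"
    by (simp add: join_reduct_simps)
qed (simp_all add: join_reduct_simps l_distr r_distr m_assoc)

text \<open>Pointwise multiplication by \<open>a\<close> does not enlarge supports, since \<open>a \<otimes> \<zero> = \<zero>\<close>, so it acts on
  the functions of finite support.\<close>

theorem embeddable_End_finsupp:
  fixes X :: "'x set"
  assumes "X \<noteq> {}"
  shows "embeddable A (End (finsupp (join_reduct A) X))"
proof (rule faithful_action_embeddable[where act = "\<lambda>a f. \<lambda>x\<in>X. a \<otimes> f x"])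
  let ?F = "finsupp (join_reduct A) X"
  note simps = finsupp_simps join_reduct_simps
  show "monoid ?F"
    using finsupp_semilattice[OF join_reduct_semilattice, of X]
    by (simp add: semilattice_with_identity_def comm_monoid_def)
  show "(\<lambda>x\<in>X. a \<otimes> f x) \<in> carrier ?F" if "a \<in> carrier A" "f \<in> carrier ?F" for a f
  proof -
    have "finite {x \<in> X. a \<otimes> f x \<noteq> \<zero>}"
      by (rule finite_subset[of _ "{x \<in> X. f x \<noteq> \<zero>}"]) (use that in \<open>auto simp: simps\<close>)
    then show ?thesis
      using that by (auto simp: simps PiE_iff cong: conj_cong)
  qed
  show "a = b"
    if ab: "a \<in> carrier A" "b \<in> carrier A"
      and eq: "\<And>f. f \<in> carrier ?F \<Longrightarrow> (\<lambda>x\<in>X. a \<otimes> f x) = (\<lambda>x\<in>X. b \<otimes> f x)" for a b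
  proof -
    obtain p where p: "p \<in> X" using assms by blast
    let ?e = "\<lambda>x\<in>X. if x = p then \<one> else \<zero>"
    have "finite {x \<in> X. ?e x \<noteq> \<zero>}"
      by (rule finite_subset[of _ "{p}"]) auto
    then have "?e \<in> carrier ?F"
      by (auto simp: simps cong: conj_cong)
    from fun_cong[OF eq[OF this], of p] show ?thesis
      using ab p by simp
  qed
qed (auto simp: finsupp_simps join_reduct_simps fun_eq_iff PiE_iff extensional_def
       l_distr r_distr m_assoc)

end

theorem corollary5p5:
  fixes A :: "('a, 'm) ring_scheme"
  assumes "mv_semiring A"
  shows "(\<forall>X :: 'x set. X \<noteq> {} \<longrightarrow> embeddable A (End (finsupp (join_reduct A) X))) \<and>
         embeddable A (End (join_reduct A))"
  using mv_semiring.embeddable_End_finsupp[OF assms] mv_semiring.embeddable_End_join_reduct[OF assms]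
  by blast

end
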